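(* Let $F$ be a field. Let $k,\ell$ be integers with $k>0$ and $0\le \ell\le k$. Let $m_1,\dots,m_k$ be positive integers such that exactly $\ell$ of them are odd and $k-\ell$ of them are even, and put $N_{k,\ell}=\sum_{i=1}^k m_i-2k+\ell+2$. Then there exists a unital associative $F$-algebra $A$ such that: (i) $T^{(1+N_{k,\ell})}(A)=0$, i.e. $[u_1,\dots,u_{1+N_{k,\ell}}]=0$ for all $u_i\in A$ ($A$ is Lie nilpotent of class at most $N_{k,\ell}$); (ii) there exist elements $v_{ij}\in A$ ($1\le i\le k$, $1\le j\le m_i$) such that \[ [v_{11},\dots,v_{1m_1}]\,[v_{21},\dots,v_{2m_2}]\cdots[v_{k1},\dots,v_{km_k}]\neq 0. \]
   Context: For an associative algebra $A$, left-normed commutators are defined by $[a_1,a_2]=a_1a_2-a_2a_1$ and $[a_1,\dots,a_{n-1},a_n]=[[a_1,\dots,a_{n-1}],a_n]$ for $n\ge 3$; a commutator $[a_1]$ of length one is just $a_1$. For $n\ge 2$, $T^{(n)}(A)$ denotes the two-sided ideal of $A$ generated by all commutators $[a_1,\dots,a_n]$ with $a_i\in A$, and $T^{(1)}(A)=A$. *)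

theory Defs
  imports "HOL-Algebra.Ideal"
begin

definition unital_F_algebra :: "('f::field \<Rightarrow> 'b \<Rightarrow> 'b) \<Rightarrow> 'b ring \<Rightarrow> bool" where
  "unital_F_algebra sm A \<longleftrightarrow>
     ring A \<and>
     (\<forall>c x. x \<in> carrier A \<longrightarrow> sm c x \<in> carrier A) \<and>
     (\<forall>c d x. x \<in> carrier A \<longrightarrow> sm (c + d) x = sm c x \<oplus>\<^bsub>A\<^esub> sm d x) \<and>
     (\<forall>c x y. x \<in> carrier A \<longrightarrow> y \<in> carrier A \<longrightarrow>
                sm c (x \<oplus>\<^bsub>A\<^esub> y) = sm c x \<oplus>\<^bsub>A\<^esub> sm c y) \<and>
     (\<forall>c d x. x \<in> carrier A \<longrightarrow> sm (c * d) x = sm c (sm d x)) \<and>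
     (\<forall>x. x \<in> carrier A \<longrightarrow> sm 1 x = x) \<and>
     (\<forall>c x y. x \<in> carrier A \<longrightarrow> y \<in> carrier A \<longrightarrow>
                sm c (x \<otimes>\<^bsub>A\<^esub> y) = sm c x \<otimes>\<^bsub>A\<^esub> y) \<and>
     (\<forall>c x y. x \<in> carrier A \<longrightarrow> y \<in> carrier A \<longrightarrow>
                sm c (x \<otimes>\<^bsub>A\<^esub> y) = x \<otimes>\<^bsub>A\<^esub> sm c y)"

definition comm2 :: "('b, 'm) ring_scheme \<Rightarrow> 'b \<Rightarrow> 'b \<Rightarrow> 'b" where
  "comm2 A a b = (a \<otimes>\<^bsub>A\<^esub> b) \<ominus>\<^bsub>A\<^esub> (b \<otimes>\<^bsub>A\<^esub> a)"

fun lcomm :: "('b, 'm) ring_scheme \<Rightarrow> 'b list \<Rightarrow> 'b" where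
  "lcomm A [] = \<zero>\<^bsub>A\<^esub>"
| "lcomm A (a # as) = foldl (comm2 A) a as"

definition Tn :: "nat \<Rightarrow> ('b, 'm) ring_scheme \<Rightarrow> 'b set" where
  "Tn n A = (if n \<le> 1 then carrier A
             else genideal A {lcomm A us | us. length us = n \<and> set us \<subseteq> carrier A})"

end

theory Submission
  imports Defs "HOL-Algebra.Weak_Morphisms" "HOL-Library.Countable" "HOL-Library.Product_Lexorder"
    "HOL-Library.Set_Algebras"
begin

text \<open>
  Let \<open>c\<^sub>i\<close> be Grassmann variables, some of them declared high and, for \<open>s\<close> the sum of the
  \<open>(m\<^sub>i - 1) div 2\<close>, \<open>2 s\<close> others declared low. The algebra has a basis of monomials \<open>g\<^sub>S\<close>
  (\<open>S\<close> a finite set of indices) over the commutative even part of the Grassmann algebra, with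
  \<open>g\<^sub>S g\<^sub>T = \<lambda>(S, T) g\<^bsub>S \<union> T\<^esub>\<close> for disjoint \<open>S\<close>, \<open>T\<close> and \<open>0\<close> otherwise. Here \<open>\<lambda>\<close> is a bicharacter with
  \<open>\<lambda>(S, T) = \<lambda>(T, S) (1 + x\<^sub>S x\<^sub>T) (1 + y\<^sub>S y\<^sub>T)\<close>, where \<open>x\<^sub>S\<close> and \<open>y\<^sub>S\<close> are the sums of the high and of the
  low variables with index in \<open>S\<close>; it exists in every characteristic, since \<open>1 + c\<^sub>i c\<^sub>j\<close> can be
  charged to just one of the two orders of \<open>i\<close> and \<open>j\<close>.

  A left-normed commutator of monomials is therefore a unit times the product of the
  \<open>(1 + x\<^sub>S x\<^sub>T) (1 + y\<^sub>S y\<^sub>T) - 1\<close>, with \<open>S\<close> running through the partial unions of the index sets and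
  \<open>T\<close> the next index set; as \<open>x\<^sub>S\<^sup>2 = 0\<close>, this \<open>T\<close> may be replaced by \<open>S \<union> T\<close>. Because
  \<open>x\<^sub>S x\<^sub>T x\<^sub>T x\<^sub>U = 0\<close>, the factors \<open>x x\<close> and \<open>y y\<close> must alternate, so a commutator of length \<open>2 s + 3\<close>
  contains \<open>s + 1\<close> factors of degree two in the \<open>2 s\<close> low variables and vanishes. On the other hand a
  commutator of length \<open>m\<close> can be chosen to be a unit times a Grassmann monomial with only
  \<open>2 ((m - 1) div 2)\<close> low variables, so there are enough of them for the product in question.
\<close>

section \<open>Left-normed commutators\<close>

lemma lcomm_snoc: "us \<noteq> [] \<Longrightarrow> lcomm A (us @ [x]) = comm2 A (lcomm A us) x"
  by (cases us) simp_all

definition prod_lcomm :: "('a, 'b) ring_scheme \<Rightarrow> (nat \<Rightarrow> 'a list) \<Rightarrow> nat \<Rightarrow> 'a"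
  where "prod_lcomm A us n = foldl (\<lambda>acc i. acc \<otimes>\<^bsub>A\<^esub> lcomm A (us i)) \<one>\<^bsub>A\<^esub> [0..<n]"

lemma prod_lcomm_0 [simp]: "prod_lcomm A us 0 = \<one>\<^bsub>A\<^esub>"
  by (simp add: prod_lcomm_def)

lemma prod_lcomm_Suc [simp]: "prod_lcomm A us (Suc n) = prod_lcomm A us n \<otimes>\<^bsub>A\<^esub> lcomm A (us n)"
  by (simp add: prod_lcomm_def)

lemma (in ring) lcomm_closed: "set us \<subseteq> carrier R \<Longrightarrow> lcomm R us \<in> carrier R"
proof (induction us rule: rev_induct)
  case (snoc x us)
  then show ?case by (cases "us = []") (auto simp: lcomm_snoc comm2_def)
qed simp

lemma (in ring) Tn_eq_zero:
  assumes "2 \<le> n" "\<And>us. length us = n \<Longrightarrow> set us \<subseteq> carrier R \<Longrightarrow> lcomm R us = \<zero>"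
  shows "Tn n R = {\<zero>}"
proof -
  let ?C = "{lcomm R us | us. length us = n \<and> set us \<subseteq> carrier R}"
  have "?C \<subseteq> {\<zero>}" using assms(2) by auto
  then have "Idl ?C \<subseteq> {\<zero>}" by (intro genideal_minimal zeroideal)
  moreover have "ideal (Idl ?C) R" using lcomm_closed by (intro genideal_ideal) auto
  then have "\<zero> \<in> Idl ?C" by (rule additive_subgroup.zero_closed[OF ideal.axioms(1)])
  ultimately show ?thesis using assms(1) by (auto simp: Tn_def)
qed

lemma (in ring_hom_ring) hom_lcomm:
  "set us \<subseteq> carrier R \<Longrightarrow> h (lcomm R us) = lcomm S (map h us)"
proof (induction us rule: rev_induct)
  case (snoc x us)
  then show ?case
    by (cases "us = []") (auto simp: lcomm_snoc comm2_def a_minus_def R.lcomm_closed)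
qed simp

lemma (in ring_hom_ring) lcomm_eq_zero_if_surj:
  assumes "carrier S = h ` carrier R"
    and "\<And>us. length us = length vs \<Longrightarrow> set us \<subseteq> carrier R \<Longrightarrow> lcomm R us = \<zero>"
    and "set vs \<subseteq> carrier S"
  shows "lcomm S vs = \<zero>\<^bsub>S\<^esub>"
proof -
  have "vs \<in> map h ` lists (carrier R)"
    using assms(1,3) unfolding lists_image[symmetric] by auto
  then obtain us where "vs = map h us" "set us \<subseteq> carrier R" by auto
  with assms(2) show ?thesis by (simp flip: hom_lcomm)
qed

lemma (in ring_hom_ring) hom_prod_lcomm:
  assumes "\<And>i. i < n \<Longrightarrow> set (us i) \<subseteq> carrier R"
  shows "prod_lcomm R us n \<in> carrier R \<and> h (prod_lcomm R us n) = prod_lcomm S (\<lambda>i. map h (us i)) n"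
  using assms by (induction n) (auto simp: hom_lcomm R.lcomm_closed)

lemma (in ring_hom_ring) prod_lcomm_nonzero_if_inj:
  assumes "inj_on h (carrier R)" "\<And>i. i < n \<Longrightarrow> set (us i) \<subseteq> carrier R" "prod_lcomm R us n \<noteq> \<zero>"
  shows "prod_lcomm S (\<lambda>i. map h (us i)) n \<noteq> \<zero>\<^bsub>S\<^esub>"
  using hom_prod_lcomm[of n us] assms by (metis hom_zero inj_onD R.zero_closed)

lemma (in ring) ring_hom_ring_image_ring:
  assumes "inj_on h (carrier R)"
  shows "ring_hom_ring R (image_ring h R) h"
  using inj_imp_image_ring_iso[OF assms] inj_imp_image_ring_is_ring[OF assms] ring_axioms
  by (auto simp: ring_iso_def intro: ring_hom_ringI2)

lemma unital_F_algebra_image_ring: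
  assumes "unital_F_algebra sm R" "inj_on h (carrier R)"
  shows "unital_F_algebra (\<lambda>c x. h (sm c (inv_into (carrier R) h x))) (image_ring h R)"
proof -
  interpret ring R using assms(1) by (simp add: unital_F_algebra_def)
  show ?thesis
    using assms inj_imp_image_ring_is_ring[OF assms(2)]
    by (auto simp: unital_F_algebra_def image_ring_def image_group_def monoid.defs)
qed

section \<open>Twisted convolution on finite sets\<close>

definition bichar :: "('i \<Rightarrow> 'i \<Rightarrow> 'r::comm_monoid_mult) \<Rightarrow> 'i set \<Rightarrow> 'i set \<Rightarrow> 'r"
  where "bichar q S T = (\<Prod>i\<in>S. \<Prod>j\<in>T. q i j)"

lemma bichar_empty [simp]: "bichar q {} T = 1" "bichar q S {} = 1"
  by (simp_all add: bichar_def)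

lemma bichar_union_left:
  "finite S \<Longrightarrow> finite T \<Longrightarrow> S \<inter> T = {} \<Longrightarrow> bichar q (S \<union> T) U = bichar q S U * bichar q T U"
  by (simp add: bichar_def prod.union_disjoint)

lemma bichar_union_right:
  "finite S \<Longrightarrow> finite T \<Longrightarrow> S \<inter> T = {} \<Longrightarrow> bichar q U (S \<union> T) = bichar q U S * bichar q U T"
  by (simp add: bichar_def prod.union_disjoint prod.distrib)

lemma bichar_mult: "bichar (\<lambda>i j. q i j * p i j) S T = bichar q S T * bichar p S T"
  by (simp add: bichar_def prod.distrib)

lemma bichar_dvd_1:
  fixes q :: "'i \<Rightarrow> 'i \<Rightarrow> 'r::comm_semiring_1"
  assumes "\<And>i j. q i j dvd 1"
  shows "bichar q S T dvd 1"
proof -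
  have "bichar q S T dvd (\<Prod>i\<in>S. \<Prod>j\<in>T. 1)"
    unfolding bichar_def by (intro prod_dvd_prod assms)
  then show ?thesis by simp
qed

lemma bichar_swap:
  assumes "\<And>i j. i \<noteq> j \<Longrightarrow> q i j = q j i * p i j" "S \<inter> T = {}"
  shows "bichar q S T = bichar q T S * bichar p S T"
proof -
  have "bichar q S T = (\<Prod>i\<in>S. \<Prod>j\<in>T. q j i * p i j)"
    unfolding bichar_def using assms by (intro prod.cong refl) (metis disjoint_iff)
  also have "\<dots> = (\<Prod>i\<in>S. \<Prod>j\<in>T. q j i) * bichar p S T"
    by (simp add: bichar_def prod.distrib)
  also have "(\<Prod>i\<in>S. \<Prod>j\<in>T. q j i) = bichar q T S"
    unfolding bichar_def by (rule prod.swap)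
  finally show ?thesis .
qed

lemma bichar_cocycle:
  assumes "finite S" "finite T" "finite U" "S \<inter> T = {}" "T \<inter> U = {}"
  shows "bichar q (S \<union> T) U * bichar q S T = bichar q S (T \<union> U) * bichar q T U"
  using assms by (simp add: bichar_union_left bichar_union_right mult_ac)

definition twisted_conv ::
    "('i \<Rightarrow> 'i \<Rightarrow> 'r::comm_ring_1) \<Rightarrow> ('i set \<Rightarrow> 'r) \<Rightarrow> ('i set \<Rightarrow> 'r) \<Rightarrow> 'i set \<Rightarrow> 'r"
  where "twisted_conv q f g S = (\<Sum>T\<in>Pow S. bichar q T (S - T) * f T * g (S - T))"

definition monomial :: "'r::zero \<Rightarrow> 'i set \<Rightarrow> 'i set \<Rightarrow> 'r"
  where "monomial c A S = (if S = A then c else 0)"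

definition finitary :: "('i set \<Rightarrow> 'r::zero) set"
  where "finitary = {f. \<forall>S. infinite S \<longrightarrow> f S = 0}"

lemma finitaryI: "(\<And>S. infinite S \<Longrightarrow> f S = 0) \<Longrightarrow> f \<in> finitary"
  by (simp add: finitary_def)

lemma finitaryD: "f \<in> finitary \<Longrightarrow> infinite S \<Longrightarrow> f S = 0"
  by (simp add: finitary_def)

lemma monomial_finitary [simp]: "finite A \<Longrightarrow> monomial c A \<in> finitary"
  by (auto simp: finitary_def monomial_def)

lemma twisted_conv_infinite: "infinite S \<Longrightarrow> twisted_conv q f g S = 0"
  by (simp add: twisted_conv_def)

lemma twisted_conv_finitary [simp]: "twisted_conv q f g \<in> finitary"
  by (simp add: finitaryI twisted_conv_infinite)

lemma twisted_conv_nonzeroE: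
  assumes "twisted_conv q f g S \<noteq> 0"
  obtains T where "finite S" "T \<subseteq> S" "f T \<noteq> 0" "g (S - T) \<noteq> 0"
proof -
  have "finite S" using assms twisted_conv_infinite by blast
  moreover have "\<exists>T\<in>Pow S. bichar q T (S - T) * f T * g (S - T) \<noteq> 0"
    using assms unfolding twisted_conv_def by (meson sum.neutral)
  ultimately show thesis by (auto dest!: mult_not_zero intro: that)
qed

lemma twisted_conv_add_left:
  "twisted_conv q (\<lambda>S. f S + g S) h S = twisted_conv q f h S + twisted_conv q g h S"
  by (simp add: twisted_conv_def algebra_simps sum.distrib)

lemma twisted_conv_add_right:
  "twisted_conv q h (\<lambda>S. f S + g S) S = twisted_conv q h f S + twisted_conv q h g S"
  by (simp add: twisted_conv_def algebra_simps sum.distrib)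

lemma twisted_conv_scale_left: "twisted_conv q (\<lambda>S. c * f S) h S = c * twisted_conv q f h S"
  by (simp add: twisted_conv_def algebra_simps sum_distrib_left)

lemma twisted_conv_scale_right: "twisted_conv q h (\<lambda>S. c * f S) S = c * twisted_conv q h f S"
  by (simp add: twisted_conv_def algebra_simps sum_distrib_left)

lemma twisted_conv_flip:
  "twisted_conv q g f S = (\<Sum>T\<in>Pow S. bichar q (S - T) T * f T * g (S - T))"
  unfolding twisted_conv_def
  by (rule sum.reindex_bij_witness[where i = "\<lambda>T. S - T" and j = "\<lambda>T. S - T"])
    (auto simp: double_diff)

lemma twisted_conv_monomial_disjoint:
  assumes "finite A" "finite B" "A \<inter> B = {}"
  shows "twisted_conv q (monomial c A) (monomial d B) = monomial (bichar q A B * c * d) (A \<union> B)"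
proof
  fix S
  have "twisted_conv q (monomial c A) (monomial d B) S
      = (\<Sum>T\<in>Pow S. if T = A then bichar q A (S - A) * c * monomial d B (S - A) else 0)"
    unfolding twisted_conv_def by (rule sum.cong) (auto simp: monomial_def)
  also have "\<dots> = monomial (bichar q A B * c * d) (A \<union> B) S"
  proof (cases "finite S")
    case True
    moreover have "A \<subseteq> S \<and> S - A = B \<longleftrightarrow> S = A \<union> B"
      using assms(3) by auto
    ultimately show ?thesis
      by (auto simp: monomial_def)
  next
    case False
    then show ?thesis using assms by (auto simp: monomial_def)
  qed
  finally show "twisted_conv q (monomial c A) (monomial d B) S
      = monomial (bichar q A B * c * d) (A \<union> B) S" .
qed

lemma twisted_conv_monomial_meet:
  "A \<inter> B \<noteq> {} \<Longrightarrow> twisted_conv q (monomial c A) (monomial d B) S = 0"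
  unfolding twisted_conv_def by (rule sum.neutral) (auto simp: monomial_def)

lemma twisted_conv_one_left:
  assumes "f \<in> finitary"
  shows "twisted_conv q (monomial 1 {}) f = f"
proof
  fix S
  have "twisted_conv q (monomial 1 {}) f S = (\<Sum>T\<in>Pow S. if T = {} then f S else 0)"
    unfolding twisted_conv_def by (rule sum.cong) (auto simp: monomial_def)
  then show "twisted_conv q (monomial 1 {}) f S = f S"
    using assms by (cases "finite S") (auto simp: finitaryD)
qed

lemma twisted_conv_one_right:
  assumes "f \<in> finitary"
  shows "twisted_conv q f (monomial 1 {}) = f"
proof
  fix S
  have "twisted_conv q f (monomial 1 {}) S = (\<Sum>T\<in>Pow S. if T = S then f S else 0)"
    unfolding twisted_conv_def by (rule sum.cong) (auto simp: monomial_def)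
  then show "twisted_conv q f (monomial 1 {}) S = f S"
    using assms by (cases "finite S") (auto simp: finitaryD)
qed

lemma sum_Pow_Pow_assoc:
  assumes "finite S"
  shows "(\<Sum>T\<in>Pow S. \<Sum>U\<in>Pow T. F U (T - U) (S - T))
    = (\<Sum>U\<in>Pow S. \<Sum>V\<in>Pow (S - U). F U V (S - U - V))"
proof -
  have "(\<Sum>T\<in>Pow S. \<Sum>U\<in>Pow T. F U (T - U) (S - T))
      = (\<Sum>(T, U)\<in>Sigma (Pow S) Pow. F U (T - U) (S - T))"
    using assms by (intro sum.Sigma) (auto intro: finite_subset)
  also have "\<dots> = (\<Sum>(U, V)\<in>(SIGMA U:Pow S. Pow (S - U)). F U V (S - U - V))"
    by (rule sum.reindex_bij_witness[where i = "\<lambda>(U, V). (U \<union> V, U)" and j = "\<lambda>(T, U). (U, T - U)"])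
      (auto intro!: arg_cong[where f = "F _ _"])
  also have "\<dots> = (\<Sum>U\<in>Pow S. \<Sum>V\<in>Pow (S - U). F U V (S - U - V))"
    using assms by (intro sum.Sigma[symmetric]) auto
  finally show ?thesis .
qed

lemma twisted_conv_assoc:
  "twisted_conv q (twisted_conv q f g) h = twisted_conv q f (twisted_conv q g h)"
proof
  fix S
  show "twisted_conv q (twisted_conv q f g) h S = twisted_conv q f (twisted_conv q g h) S"
  proof (cases "finite S")
    case True
    have "twisted_conv q (twisted_conv q f g) h S = (\<Sum>T\<in>Pow S. \<Sum>U\<in>Pow T.
        bichar q (U \<union> (T - U)) (S - T) * bichar q U (T - U) * (f U * g (T - U) * h (S - T)))"
      by (auto simp: twisted_conv_def sum_distrib_left sum_distrib_right Un_absorb1 mult_ac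
          intro!: sum.cong)
    also have "\<dots> = (\<Sum>U\<in>Pow S. \<Sum>V\<in>Pow (S - U).
        bichar q (U \<union> V) (S - U - V) * bichar q U V * (f U * g V * h (S - U - V)))"
      by (rule sum_Pow_Pow_assoc[OF True])
    also have "\<dots> = (\<Sum>U\<in>Pow S. \<Sum>V\<in>Pow (S - U).
        bichar q U (V \<union> (S - U - V)) * bichar q V (S - U - V) * (f U * g V * h (S - U - V)))"
      using True by (intro sum.cong refl arg_cong2[where f = "(*)"] bichar_cocycle)
        (auto intro: finite_subset)
    also have "\<dots> = twisted_conv q f (twisted_conv q g h) S"
      by (auto simp: twisted_conv_def sum_distrib_left Un_absorb1 mult_ac intro!: sum.cong)
    finally show ?thesis .
  qed (simp add: twisted_conv_infinite)
qed

definition twisted_ring :: "('i \<Rightarrow> 'i \<Rightarrow> 'r::comm_ring_1) \<Rightarrow> ('i set \<Rightarrow> 'r) ring"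
  where "twisted_ring q = \<lparr>carrier = finitary, mult = twisted_conv q, one = monomial 1 {},
    zero = (\<lambda>_. 0), add = (\<lambda>f g S. f S + g S)\<rparr>"

lemma twisted_ring_simps [simp]:
  "carrier (twisted_ring q) = finitary" "mult (twisted_ring q) = twisted_conv q"
  "one (twisted_ring q) = monomial 1 {}" "zero (twisted_ring q) = (\<lambda>_. 0)"
  "add (twisted_ring q) = (\<lambda>f g S. f S + g S)"
  by (simp_all add: twisted_ring_def)

lemma ring_twisted_ring: "ring (twisted_ring q)"
proof (rule ringI)
  show "abelian_group (twisted_ring q)"
  proof (rule abelian_groupI)
    fix f assume "f \<in> carrier (twisted_ring q)"
    then show "\<exists>g\<in>carrier (twisted_ring q). g \<oplus>\<^bsub>twisted_ring q\<^esub> f = \<zero>\<^bsub>twisted_ring q\<^esub>"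
      by (intro bexI[of _ "\<lambda>S. - f S"]) (auto simp: finitary_def)
  qed (auto simp: finitary_def add_ac)
  show "monoid (twisted_ring q)"
    by (rule monoidI) (simp_all add: twisted_conv_assoc twisted_conv_one_left twisted_conv_one_right)
qed (auto simp: twisted_conv_add_left twisted_conv_add_right)

lemma minus_twisted_ring:
  assumes "g \<in> finitary"
  shows "f \<ominus>\<^bsub>twisted_ring q\<^esub> g = (\<lambda>S. f S - g S)"
proof -
  interpret ring "twisted_ring q" by (rule ring_twisted_ring)
  have "\<ominus>\<^bsub>twisted_ring q\<^esub> g = (\<lambda>S. - g S)"
    using assms by (intro minus_equality) (auto simp: finitary_def)
  then show ?thesis by (simp add: a_minus_def)
qed

lemma unital_F_algebra_twisted_ring:
  fixes \<phi> :: "'f::field \<Rightarrow> 'r::comm_ring_1"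
  assumes "\<And>c d. \<phi> (c + d) = \<phi> c + \<phi> d" "\<And>c d. \<phi> (c * d) = \<phi> c * \<phi> d" "\<phi> 1 = 1"
  shows "unital_F_algebra (\<lambda>c f S. \<phi> c * f S) (twisted_ring q)"
  unfolding unital_F_algebra_def using ring_twisted_ring[of q]
  by (auto simp: assms finitary_def distrib_left distrib_right mult.assoc fun_eq_iff
      twisted_conv_scale_left twisted_conv_scale_right)

text \<open>In the next two lemmas \<open>1 + d S T\<close> is the price of moving \<open>monomial 1 S\<close> past \<open>monomial 1 T\<close>.\<close>

lemma comm2_twisted_ring:
  assumes "\<And>S T. finite S \<Longrightarrow> finite T \<Longrightarrow> S \<inter> T = {} \<Longrightarrow> bichar q S T = bichar q T S * (1 + d S T)"
  shows "comm2 (twisted_ring q) f g S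
    = (\<Sum>T\<in>Pow S. d T (S - T) * f T * (bichar q (S - T) T * g (S - T)))"
proof (cases "finite S")
  case True
  have "comm2 (twisted_ring q) f g S = twisted_conv q f g S - twisted_conv q g f S"
    by (simp add: comm2_def minus_twisted_ring)
  also have "\<dots> = (\<Sum>T\<in>Pow S. (bichar q T (S - T) - bichar q (S - T) T) * f T * g (S - T))"
    unfolding twisted_conv_flip[of q g f] by (simp add: twisted_conv_def algebra_simps sum_subtractf)
  also have "\<dots> = (\<Sum>T\<in>Pow S. d T (S - T) * f T * (bichar q (S - T) T * g (S - T)))"
  proof (rule sum.cong)
    fix T assume "T \<in> Pow S"
    then have "bichar q T (S - T) = bichar q (S - T) T * (1 + d T (S - T))"
      using True by (intro assms) (auto intro: finite_subset)
    then show "(bichar q T (S - T) - bichar q (S - T) T) * f T * g (S - T)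
        = d T (S - T) * f T * (bichar q (S - T) T * g (S - T))"
      by (simp add: algebra_simps)
  qed simp
  finally show ?thesis .
qed (simp add: comm2_def minus_twisted_ring twisted_conv_infinite)

lemma comm2_twisted_ring_monomial:
  assumes "bichar q S T = bichar q T S * (1 + d S T)" "finite S" "finite T" "S \<inter> T = {}"
  shows "comm2 (twisted_ring q) (monomial c S) (monomial e T)
    = monomial (bichar q T S * (d S T * c) * e) (S \<union> T)"
proof -
  have "T \<inter> S = {}" using assms(4) by auto
  then have "comm2 (twisted_ring q) (monomial c S) (monomial e T)
      = monomial ((bichar q S T - bichar q T S) * c * e) (S \<union> T)"
    using assms(2-4)
    by (auto simp: comm2_def minus_twisted_ring twisted_conv_monomial_disjoint monomial_def
        algebra_simps Un_commute)
  then show ?thesis by (simp add: assms(1) algebra_simps)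
qed

section \<open>The even part of the Grassmann algebra\<close>

definition inversion_sign :: "'i::linorder \<Rightarrow> 'i \<Rightarrow> 'f::comm_ring_1"
  where "inversion_sign i j = (if j < i then - 1 else 1)"

lemma inversion_sign_swap: "i \<noteq> j \<Longrightarrow> inversion_sign i j = (- inversion_sign j i :: 'f::comm_ring_1)"
  by (auto simp: inversion_sign_def)

lemma inversion_sign_dvd_1: "inversion_sign i j dvd 1"
  by (simp add: inversion_sign_def)

lemma bichar_inversion_sign_swap:
  assumes "S \<inter> T = {}" "even (card S)"
  shows "bichar inversion_sign S T = bichar inversion_sign T S"
proof -
  have "bichar inversion_sign S T = bichar inversion_sign T S * bichar (\<lambda>_ _. - 1 :: 'b) S T"
    by (rule bichar_swap) (use assms(1) inversion_sign_swap in auto)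
  also have "bichar (\<lambda>_ _. - 1 :: 'b) S T = 1"
    using assms(2) by (simp add: bichar_def flip: power_mult)
  finally show ?thesis by simp
qed

typedef (overloaded) ('i, 'f::comm_ring_1) even_grassmann =
  "{f :: 'i set \<Rightarrow> 'f. \<forall>P. f P \<noteq> 0 \<longrightarrow> finite P \<and> even (card P)}"
  morphisms coef Abs_even_grassmann
  by (rule exI[of _ "\<lambda>_. 0"]) simp

setup_lifting type_definition_even_grassmann

lemma even_grassmann_eqI: "(\<And>P. coef x P = coef y P) \<Longrightarrow> x = y"
  by transfer auto

lemma coef_finitary: "coef x \<in> finitary"
  using coef[of x] by (auto simp: finitary_def)

lemma twisted_conv_even_support:
  assumes "\<And>P. f P \<noteq> 0 \<Longrightarrow> even (card P)" "\<And>P. g P \<noteq> 0 \<Longrightarrow> even (card P)"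
    and "twisted_conv q f g S \<noteq> 0"
  shows "finite S \<and> even (card S)"
proof -
  obtain T where split: "finite S" "T \<subseteq> S" "f T \<noteq> 0" "g (S - T) \<noteq> 0"
    using assms(3) by (rule twisted_conv_nonzeroE)
  then have "card S = card T + card (S - T)"
    by (simp add: card_Diff_subset card_mono finite_subset)
  then show ?thesis using split assms(1,2) by simp
qed

instantiation even_grassmann :: (linorder, comm_ring_1) comm_ring_1
begin

lift_definition zero_even_grassmann :: "('a, 'b) even_grassmann" is "\<lambda>_. 0"
  by simp
lift_definition one_even_grassmann :: "('a, 'b) even_grassmann" is "monomial 1 {}"
  by (auto simp: monomial_def split: if_splits)
lift_definition plus_even_grassmann ::
  "('a, 'b) even_grassmann \<Rightarrow> ('a, 'b) even_grassmann \<Rightarrow> ('a, 'b) even_grassmann"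
  is "\<lambda>f g P. f P + g P"
  by (metis add.right_neutral)
lift_definition minus_even_grassmann ::
  "('a, 'b) even_grassmann \<Rightarrow> ('a, 'b) even_grassmann \<Rightarrow> ('a, 'b) even_grassmann"
  is "\<lambda>f g P. f P - g P"
  by (metis diff_zero)
lift_definition uminus_even_grassmann :: "('a, 'b) even_grassmann \<Rightarrow> ('a, 'b) even_grassmann"
  is "\<lambda>f P. - f P"
  by simp
lift_definition times_even_grassmann ::
  "('a, 'b) even_grassmann \<Rightarrow> ('a, 'b) even_grassmann \<Rightarrow> ('a, 'b) even_grassmann"
  is "twisted_conv inversion_sign"
  using twisted_conv_even_support by blast

instance
proof
  fix x y z :: "('a, 'b) even_grassmann"
  show "x * y * z = x * (y * z)" by transfer (rule twisted_conv_assoc)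
  show "x * y = y * x"
  proof transfer
    fix f g :: "'a set \<Rightarrow> 'b"
    assume even_f: "\<forall>P. f P \<noteq> 0 \<longrightarrow> finite P \<and> even (card P)"
    have "bichar inversion_sign T (S - T) * f T = bichar inversion_sign (S - T) T * f T" for S T
    proof (cases "f T = 0")
      case False
      with even_f have "bichar inversion_sign T (S - T) = (bichar inversion_sign (S - T) T :: 'b)"
        by (intro bichar_inversion_sign_swap) auto
      then show ?thesis by simp
    qed simp
    then show "twisted_conv inversion_sign f g = twisted_conv inversion_sign g f"
      by (intro ext) (simp add: twisted_conv_flip[of _ g f], simp add: twisted_conv_def)
  qed
  show "1 * x = x"
    by transfer (rule twisted_conv_one_left, auto simp: finitary_def)
  show "(x + y) * z = x * z + y * z" by transfer (auto simp: twisted_conv_add_left)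
  show "0 \<noteq> (1 :: ('a, 'b) even_grassmann)" by transfer (auto simp: monomial_def fun_eq_iff)
qed (transfer, simp add: algebra_simps; fail)+

end

lemma coef_simps [simp]:
  "coef 0 P = 0" "coef (x + y) P = coef x P + coef y P"
  by (transfer, simp)+

lemma coef_mult: "coef (x * y) = twisted_conv inversion_sign (coef x) (coef y)"
  by transfer simp

text \<open>\<open>even_monomial c {i\<^sub>1 < \<dots> < i\<^sub>n}\<close> is \<open>c c\<^bsub>i\<^sub>1\<^esub> \<dots> c\<^bsub>i\<^sub>n\<^esub>\<close>, with junk value \<open>0\<close> unless \<open>n\<close> is even.\<close>

lift_definition even_monomial :: "'f::comm_ring_1 \<Rightarrow> 'i set \<Rightarrow> ('i, 'f) even_grassmann"
  is "\<lambda>c P. if finite P \<and> even (card P) then monomial c P else (\<lambda>_. 0)"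
  by (auto simp: monomial_def split: if_splits)

lemma coef_even_monomial: "finite P \<Longrightarrow> even (card P) \<Longrightarrow> coef (even_monomial c P) = monomial c P"
  by transfer simp

lemma even_monomial_empty: "even_monomial 1 {} = 1"
  by transfer simp

lemma even_monomial_add: "even_monomial (c + d) P = even_monomial c P + even_monomial d P"
  by transfer (auto simp: monomial_def)

lemma even_monomial_minus: "even_monomial (- c) P = - even_monomial c P"
  by transfer (auto simp: monomial_def)

lemma even_monomial_nonzero:
  "finite P \<Longrightarrow> even (card P) \<Longrightarrow> even_monomial (1 :: 'f::comm_ring_1) P \<noteq> 0"
  by transfer (auto simp: monomial_def fun_eq_iff)

lemma even_monomial_mult_disjoint:
  fixes P Q :: "'i::linorder set"
  assumes "finite P" "even (card P)" "finite Q" "even (card Q)" "P \<inter> Q = {}"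
  shows "even_monomial c P * even_monomial d Q
    = even_monomial (bichar inversion_sign P Q * c * d) (P \<union> Q)"
proof -
  have "even (card (P \<union> Q))" using assms by (simp add: card_Un_disjoint)
  then show ?thesis
    using assms by (intro even_grassmann_eqI)
      (simp add: coef_mult coef_even_monomial twisted_conv_monomial_disjoint)
qed

lemma even_monomial_mult_meet:
  fixes P Q :: "'i::linorder set"
  assumes "finite P" "even (card P)" "finite Q" "even (card Q)" "P \<inter> Q \<noteq> {}"
  shows "even_monomial c P * even_monomial d Q = 0"
  using assms by (intro even_grassmann_eqI)
    (simp add: coef_mult coef_even_monomial twisted_conv_monomial_meet)

section \<open>Products of two Grassmann variables\<close>

lemma sum_alternating:
  fixes a :: "'a \<Rightarrow> 'a \<Rightarrow> 'r::ab_group_add"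
  assumes "finite T" "\<And>j. a j j = 0" "\<And>j k. a j k = - a k j"
  shows "(\<Sum>j\<in>T. \<Sum>k\<in>T. a j k) = 0"
  using assms(1)
proof induction
  case (insert x T)
  have "(\<Sum>j\<in>T. a j x) = - (\<Sum>k\<in>T. a x k)"
    by (subst assms(3)) (simp add: sum_negf)
  with insert show ?case
    by (simp add: sum.distrib assms(2))
qed simp

lemma prod_one_plus_orthogonal:
  fixes a :: "'i \<Rightarrow> 'r::comm_semiring_1"
  assumes "finite S" "\<And>i j. i \<noteq> j \<Longrightarrow> a i * a j = 0"
  shows "(\<Prod>i\<in>S. 1 + a i) = 1 + (\<Sum>i\<in>S. a i)"
  using assms(1)
proof induction
  case (insert i S)
  have "a i * (\<Sum>j\<in>S. a j) = 0"
    using insert by (auto simp: sum_distrib_left intro!: sum.neutral assms(2))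
  with insert show ?case by (simp add: distrib_left distrib_right add_ac)
qed simp

definition wedge :: "'i::linorder \<Rightarrow> 'i \<Rightarrow> ('i, 'f::comm_ring_1) even_grassmann"
  where "wedge i j = (if i = j then 0 else even_monomial (inversion_sign i j) {i, j})"

definition wedge_sum :: "'i::linorder set \<Rightarrow> 'i set \<Rightarrow> ('i, 'f::comm_ring_1) even_grassmann"
  where "wedge_sum S T = (\<Sum>i\<in>S. \<Sum>j\<in>T. wedge i j)"

lemma wedge_self [simp]: "wedge i i = 0"
  by (simp add: wedge_def)

lemma wedge_anti: "wedge i j = - wedge j i"
  using inversion_sign_swap[of i j, where 'f = 'b]
  by (auto simp: wedge_def insert_commute simp flip: even_monomial_minus)

lemma even_monomial_mult_wedge_meet:
  assumes "finite P" "even (card P)" "{i, j} \<inter> P \<noteq> {}"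
  shows "even_monomial c P * wedge i j = 0"
  using assms by (auto simp: wedge_def even_monomial_mult_meet)

lemma wedge_mult_meet: "{i, j} \<inter> {k, l} \<noteq> {} \<Longrightarrow> wedge i j * wedge k l = 0"
  by (cases "i = j") (auto simp: even_monomial_mult_wedge_meet wedge_def[of i j])

lemma wedge_mult_distinct:
  assumes "distinct [i, j, k, l]"
  shows "wedge i j * wedge k l = even_monomial (inversion_sign i j * inversion_sign k l
    * inversion_sign i k * inversion_sign i l * inversion_sign j k * inversion_sign j l) {i, j, k, l}"
proof -
  have "bichar inversion_sign {i, j} {k, l} = inversion_sign i k * inversion_sign i l *
      (inversion_sign j k * (inversion_sign j l :: 'b))"
    using assms by (simp add: bichar_def)
  moreover have "{i, j} \<union> {k, l} = {i, j, k, l}" by auto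
  ultimately show ?thesis
    using assms by (simp add: wedge_def even_monomial_mult_disjoint mult_ac)
qed

lemma wedge_chain: "wedge i j * wedge j k = 0"
  by (simp add: wedge_mult_meet)

lemma wedge_exchange: "wedge i j * wedge k l = - (wedge i k * wedge j l)"
proof (cases "distinct [i, j, k, l]")
  case True
  then have distinct': "distinct [i, k, j, l]" and "k \<noteq> j" by auto
  moreover have "{i, k, j, l} = {i, j, k, l}" by auto
  ultimately show ?thesis
    by (simp add: wedge_mult_distinct[OF True] wedge_mult_distinct[OF distinct']
        inversion_sign_swap[of k j] even_monomial_minus mult_ac)
next
  case False
  then consider "i = j \<or> k = l" | "i = k \<or> j = l" | "i = l" | "j = k" by auto
  then show ?thesis
    by cases (auto simp: wedge_mult_meet)
qed

lemma wedge_sum_empty [simp]: "wedge_sum {} T = 0"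
  by (simp add: wedge_sum_def)

lemma wedge_sum_union_right:
  "finite S \<Longrightarrow> finite T \<Longrightarrow> S \<inter> T = {} \<Longrightarrow> wedge_sum U (S \<union> T) = wedge_sum U S + wedge_sum U T"
  by (simp add: wedge_sum_def sum.union_disjoint sum.distrib)

lemma wedge_sum_anti: "wedge_sum S T = - wedge_sum T S"
proof -
  have "wedge_sum S T = (\<Sum>j\<in>T. \<Sum>i\<in>S. wedge i j)"
    unfolding wedge_sum_def by (rule sum.swap)
  also have "\<dots> = (\<Sum>j\<in>T. \<Sum>i\<in>S. - wedge j i)"
    by (intro sum.cong refl wedge_anti)
  finally show ?thesis by (simp add: wedge_sum_def sum_negf)
qed

lemma wedge_sum_self: "finite S \<Longrightarrow> wedge_sum S S = 0"
  unfolding wedge_sum_def by (rule sum_alternating) (auto intro: wedge_anti)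

lemma wedge_sum_Diff:
  assumes "finite S" "T \<subseteq> S"
  shows "wedge_sum T (S - T) = wedge_sum T S"
proof -
  have "finite T" using assms finite_subset by blast
  have "wedge_sum T (S - T) = wedge_sum T (S - T) + wedge_sum T T"
    using \<open>finite T\<close> by (simp add: wedge_sum_self)
  also have "\<dots> = wedge_sum T ((S - T) \<union> T)"
    using assms \<open>finite T\<close> by (intro wedge_sum_union_right[symmetric]) auto
  also have "(S - T) \<union> T = S" using assms(2) by auto
  finally show ?thesis .
qed

lemma wedge_sum_chain:
  assumes "finite T"
  shows "wedge_sum S T * wedge_sum T U = 0"
proof -
  have "wedge_sum S T * wedge_sum T U
      = ((\<Sum>i\<in>S. \<Sum>l\<in>U. \<Sum>j\<in>T. \<Sum>k\<in>T. wedge i j * wedge k l) :: ('a, 'b) even_grassmann)"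
    by (simp add: wedge_sum_def sum_product sum.swap[of _ U T])
  moreover have "(\<Sum>j\<in>T. \<Sum>k\<in>T. wedge i j * wedge k l :: ('a, 'b) even_grassmann) = 0" for i l
    using assms by (intro sum_alternating wedge_chain wedge_exchange)
  ultimately show ?thesis by simp
qed

lemma wedge_sum_fork: "finite T \<Longrightarrow> wedge_sum S T * wedge_sum U T = 0"
  by (subst (2) wedge_sum_anti) (simp add: wedge_sum_chain)

lemma bichar_one_plus_wedge:
  assumes "finite S" "finite T"
  shows "bichar (\<lambda>i j. 1 + wedge i j) S T = 1 + wedge_sum S T"
proof -
  have "wedge i j * wedge i k = (0 :: ('a, 'b) even_grassmann)" for i j k
    by (simp add: wedge_mult_meet)
  then have "(\<Prod>j\<in>T. 1 + wedge i j) = (1 + wedge_sum {i} T :: ('a, 'b) even_grassmann)" for i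
    using assms(2) by (simp add: prod_one_plus_orthogonal wedge_sum_def)
  moreover have "(\<Prod>i\<in>S. 1 + wedge_sum {i} T)
      = (1 + (\<Sum>i\<in>S. wedge_sum {i} T) :: ('a, 'b) even_grassmann)"
    using assms by (intro prod_one_plus_orthogonal wedge_sum_fork)
  ultimately show ?thesis by (simp add: bichar_def wedge_sum_def)
qed

section \<open>Degree in a set of variables\<close>

definition degree_ge :: "'i set \<Rightarrow> nat \<Rightarrow> ('i, 'f::comm_ring_1) even_grassmann \<Rightarrow> bool"
  where "degree_ge L d x \<longleftrightarrow> (\<forall>P. coef x P \<noteq> 0 \<longrightarrow> d \<le> card (P \<inter> L))"

lemma degree_ge_0 [simp]: "degree_ge L 0 x"
  by (simp add: degree_ge_def)

lemma degree_ge_zero [simp]: "degree_ge L d 0"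
  by (simp add: degree_ge_def)

lemma degree_ge_add: "degree_ge L d x \<Longrightarrow> degree_ge L d y \<Longrightarrow> degree_ge L d (x + y)"
  by (auto simp: degree_ge_def) (metis add.right_neutral)

lemma degree_ge_mult:
  assumes "degree_ge L d x" "degree_ge L e y"
  shows "degree_ge L (d + e) (x * y)"
  unfolding degree_ge_def
proof (intro allI impI)
  fix P assume "coef (x * y) P \<noteq> 0"
  then obtain T where split: "finite P" "T \<subseteq> P" "coef x T \<noteq> 0" "coef y (P - T) \<noteq> 0"
    unfolding coef_mult by (rule twisted_conv_nonzeroE)
  then have "d + e \<le> card (T \<inter> L) + card ((P - T) \<inter> L)"
    using assms by (simp add: degree_ge_def add_mono)
  also have "\<dots> = card ((T \<inter> L) \<union> ((P - T) \<inter> L))"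
    using split by (intro card_Un_disjoint[symmetric]) (auto intro: finite_subset)
  also have "(T \<inter> L) \<union> ((P - T) \<inter> L) = P \<inter> L" using split(2) by auto
  finally show "d + e \<le> card (P \<inter> L)" .
qed

lemma degree_ge_sum: "(\<And>i. i \<in> I \<Longrightarrow> degree_ge L d (f i)) \<Longrightarrow> degree_ge L d (sum f I)"
  by (induction I rule: infinite_finite_induct) (auto intro: degree_ge_add)

lemma degree_ge_wedge:
  assumes "i \<in> L" "j \<in> L"
  shows "degree_ge L 2 (wedge i j)"
proof (cases "i = j")
  case False
  have "{i, j} \<inter> L = {i, j}" using assms by auto
  with False show ?thesis
    by (simp add: degree_ge_def wedge_def coef_even_monomial monomial_def)
qed simp

lemma degree_ge_wedge_sum: "degree_ge L 2 (wedge_sum (S \<inter> L) (T \<inter> L))"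
  unfolding wedge_sum_def by (intro degree_ge_sum degree_ge_wedge) auto

lemma degree_ge_gt_card:
  assumes "degree_ge L d x" "finite L" "card L < d"
  shows "x = 0"
proof (rule even_grassmann_eqI)
  fix P
  have "card (P \<inter> L) \<le> card L" using assms(2) by (simp add: card_mono)
  then show "coef x P = coef 0 P" using assms(1,3) by (force simp: degree_ge_def)
qed

section \<open>The doubly twisted ring\<close>

definition wedge_twist :: "'i::linorder set \<Rightarrow> 'i \<Rightarrow> 'i \<Rightarrow> ('i, 'f::comm_ring_1) even_grassmann"
  where "wedge_twist A i j = (if j < i \<and> i \<in> A \<and> j \<in> A then 1 + wedge i j else 1)"

lemma wedge_twist_dvd_1: "wedge_twist A i j dvd 1"
proof -
  have "1 = (1 + wedge i j) * (1 - wedge i j :: ('a, 'b) even_grassmann)"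
    by (simp add: algebra_simps wedge_mult_meet)
  then have "1 + wedge i j dvd (1 :: ('a, 'b) even_grassmann)" by (rule dvdI)
  then show ?thesis by (simp add: wedge_twist_def)
qed

lemma bichar_wedge_twist_swap:
  assumes "finite S" "finite T" "S \<inter> T = {}"
  shows "bichar (wedge_twist A) S T = bichar (wedge_twist A) T S * (1 + wedge_sum (S \<inter> A) (T \<inter> A))"
proof -
  define p :: "'a \<Rightarrow> 'a \<Rightarrow> ('a, 'b) even_grassmann"
    where "p i j = (if i \<in> A \<and> j \<in> A then 1 + wedge i j else 1)" for i j
  have "bichar (wedge_twist A) S T = bichar (wedge_twist A) T S * bichar p S T"
  proof (rule bichar_swap)
    fix i j :: 'a assume "i \<noteq> j"
    moreover have "(1 + wedge j i) * (1 + wedge i j) = (1 :: ('a, 'b) even_grassmann)"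
      by (subst wedge_anti) (simp add: algebra_simps wedge_mult_meet)
    ultimately show "wedge_twist A i j = wedge_twist A j i * p i j"
      by (auto simp: wedge_twist_def p_def)
  qed fact
  also have "bichar p S T = (\<Prod>i\<in>S. if i \<in> A then \<Prod>j\<in>T. if j \<in> A then 1 + wedge i j else 1 else 1)"
    unfolding bichar_def p_def by (intro prod.cong) auto
  also have "\<dots> = bichar (\<lambda>i j. 1 + wedge i j) (S \<inter> A) (T \<inter> A)"
    using assms(1,2) by (simp add: bichar_def prod.inter_restrict)
  also have "\<dots> = 1 + wedge_sum (S \<inter> A) (T \<inter> A)"
    using assms(1,2) by (simp add: bichar_one_plus_wedge)
  finally show ?thesis .
qed

definition twist :: "'i::linorder set \<Rightarrow> 'i set \<Rightarrow> 'i \<Rightarrow> 'i \<Rightarrow> ('i, 'f::comm_ring_1) even_grassmann"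
  where "twist H L i j = wedge_twist H i j * wedge_twist L i j"

definition defect ::
    "'i::linorder set \<Rightarrow> 'i set \<Rightarrow> 'i set \<Rightarrow> 'i set \<Rightarrow> ('i, 'f::comm_ring_1) even_grassmann"
  where "defect H L S T = wedge_sum (S \<inter> H) (T \<inter> H) + wedge_sum (S \<inter> L) (T \<inter> L)
    + wedge_sum (S \<inter> H) (T \<inter> H) * wedge_sum (S \<inter> L) (T \<inter> L)"

lemma defect_commute: "defect H L S T = defect L H S T"
  by (simp add: defect_def mult.commute)

lemma bichar_twist_dvd_1: "bichar (twist H L) S T dvd 1"
  using mult_dvd_mono[OF wedge_twist_dvd_1 wedge_twist_dvd_1]
  by (intro bichar_dvd_1) (simp add: twist_def)

lemma bichar_twist_swap:
  assumes "finite S" "finite T" "S \<inter> T = {}"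
  shows "bichar (twist H L) S T = bichar (twist H L) T S * (1 + defect H L S T)"
  unfolding twist_def bichar_mult bichar_wedge_twist_swap[OF assms]
  by (simp add: defect_def algebra_simps)

abbreviation doubly_twisted_ring ::
    "'i::linorder set \<Rightarrow> 'i set \<Rightarrow> ('i set \<Rightarrow> ('i, 'f::comm_ring_1) even_grassmann) ring"
  where "doubly_twisted_ring H L \<equiv> twisted_ring (twist H L)"

lemma unital_F_algebra_doubly_twisted_ring:
  "unital_F_algebra (\<lambda>c f S. even_monomial c {} * f S) (doubly_twisted_ring H L)"
  by (rule unital_F_algebra_twisted_ring)
    (simp_all add: even_monomial_add even_monomial_mult_disjoint even_monomial_empty)

lemmas comm2_doubly_twisted_ring = comm2_twisted_ring[OF bichar_twist_swap]

lemma comm2_doubly_twisted_ring_monomial: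
  assumes "finite S" "finite T" "S \<inter> T = {}"
  shows "comm2 (doubly_twisted_ring H L) (monomial c S) (monomial e T)
    = monomial (bichar (twist H L) T S * (defect H L S T * c) * e) (S \<union> T)"
  using bichar_twist_swap[OF assms] assms by (rule comm2_twisted_ring_monomial)

section \<open>Lie nilpotency\<close>

definition wedge_annihilator ::
    "'i::linorder set \<Rightarrow> 'i set \<Rightarrow> nat \<Rightarrow> 'i set \<Rightarrow> ('i, 'f::comm_ring_1) even_grassmann set"
  where "wedge_annihilator L A d S = {x. degree_ge L d x \<and> (\<forall>U. x * wedge_sum (S \<inter> A) U = 0)}"

lemma wedge_annihilator_zero: "0 \<in> wedge_annihilator L A d S"
  by (simp add: wedge_annihilator_def)

lemma wedge_annihilator_add:
  "x \<in> wedge_annihilator L A d S \<Longrightarrow> y \<in> wedge_annihilator L A d S \<Longrightarrow> x + y \<in> wedge_annihilator L A d S"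
  by (simp add: wedge_annihilator_def degree_ge_add distrib_right)

lemma wedge_annihilator_mult:
  assumes "degree_ge L d x" "y \<in> wedge_annihilator L A e S"
  shows "x * y \<in> wedge_annihilator L A (d + e) S"
  using assms by (simp add: wedge_annihilator_def degree_ge_mult mult.assoc)

lemma wedge_sum_in_wedge_annihilator:
  assumes "finite S"
  shows "wedge_sum T (S \<inter> A) \<in> wedge_annihilator L A 0 S"
  using assms by (simp add: wedge_annihilator_def wedge_sum_chain)

lemma wedge_sum_in_wedge_annihilator_self:
  assumes "finite S"
  shows "wedge_sum (T \<inter> L) (S \<inter> L) \<in> wedge_annihilator L L 2 S"
  using assms by (simp add: wedge_annihilator_def wedge_sum_chain degree_ge_wedge_sum)

text \<open>Contains the coefficients at \<open>S\<close> of \<open>n\<close>-fold commutators. In the expansion of the product of the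
  defects along a commutator the sums over \<open>H\<close> and over \<open>L\<close> must alternate; the summand annihilated
  by the \<open>A\<close>-part of \<open>S\<close> collects the products whose last factor is a sum over \<open>A\<close>.\<close>

definition alternating_coeffs ::
    "'i::linorder set \<Rightarrow> 'i set \<Rightarrow> nat \<Rightarrow> 'i set \<Rightarrow> ('i, 'f::comm_ring_1) even_grassmann set"
  where "alternating_coeffs H L n S =
    wedge_annihilator L H (2 * ((n - 1) div 2)) S + wedge_annihilator L L (2 * (n div 2)) S"

lemma alternating_coeffs_zero: "0 \<in> alternating_coeffs H L n S"
  unfolding alternating_coeffs_def by (metis set_plus_intro wedge_annihilator_zero add_0)

lemma alternating_coeffs_add:
  assumes "x \<in> alternating_coeffs H L n S" "y \<in> alternating_coeffs H L n S"
  shows "x + y \<in> alternating_coeffs H L n S"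
proof -
  let ?P = "wedge_annihilator L H (2 * ((n - 1) div 2)) S"
    and ?Q = "wedge_annihilator L L (2 * (n div 2)) S"
  from assms obtain p q p' q' where "x = p + q" "y = p' + q'"
      and mem: "p \<in> ?P" "p' \<in> ?P" "q \<in> ?Q" "q' \<in> ?Q"
    unfolding alternating_coeffs_def by (elim set_plus_elim)
  then have "x + y = (p + p') + (q + q')" by simp
  also have "\<dots> \<in> ?P + ?Q" using mem by (intro set_plus_intro wedge_annihilator_add)
  finally show ?thesis by (simp only: alternating_coeffs_def)
qed

lemma alternating_coeffs_mult:
  assumes "x \<in> alternating_coeffs H L n S"
  shows "x * y \<in> alternating_coeffs H L n S"
proof -
  let ?P = "wedge_annihilator L H (2 * ((n - 1) div 2)) S"
    and ?Q = "wedge_annihilator L L (2 * (n div 2)) S"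
  from assms obtain p q where "x = p + q" and mem: "p \<in> ?P" "q \<in> ?Q"
    unfolding alternating_coeffs_def by (elim set_plus_elim)
  then have "x * y = y * p + y * q" by (simp add: algebra_simps)
  also have "\<dots> \<in> ?P + ?Q"
    using mem wedge_annihilator_mult[OF degree_ge_0] by (intro set_plus_intro) fastforce+
  finally show ?thesis by (simp only: alternating_coeffs_def)
qed

lemma alternating_coeffs_sum:
  "(\<And>i. i \<in> I \<Longrightarrow> f i \<in> alternating_coeffs H L n S) \<Longrightarrow> sum f I \<in> alternating_coeffs H L n S"
  by (induction I rule: infinite_finite_induct)
    (auto intro: alternating_coeffs_add alternating_coeffs_zero)

lemma defect_Diff:
  assumes "finite S" "T \<subseteq> S"
  shows "defect H L T (S - T) = wedge_sum (T \<inter> H) (S \<inter> H) + wedge_sum (T \<inter> L) (S \<inter> L)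
    + wedge_sum (T \<inter> H) (S \<inter> H) * wedge_sum (T \<inter> L) (S \<inter> L)"
proof -
  have inter_Diff: "wedge_sum (T \<inter> A) ((S - T) \<inter> A) = wedge_sum (T \<inter> A) (S \<inter> A)" for A
    unfolding Diff_Int_distrib2 using assms by (intro wedge_sum_Diff) auto
  show ?thesis by (simp add: defect_def inter_Diff)
qed

lemma defect_alternating:
  assumes "finite S" "T \<subseteq> S"
  shows "defect H L T (S - T) \<in> alternating_coeffs H L 2 S"
proof -
  let ?h = "wedge_sum (T \<inter> H) (S \<inter> H) :: ('a, 'b) even_grassmann"
    and ?l = "wedge_sum (T \<inter> L) (S \<inter> L) :: ('a, 'b) even_grassmann"
  have high: "?h \<in> wedge_annihilator L H 0 S"
    using assms(1) by (rule wedge_sum_in_wedge_annihilator)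
  then have "?l * ?h \<in> wedge_annihilator L H 0 S"
    using wedge_annihilator_mult[OF degree_ge_0] by fastforce
  with high have "?h + ?l * ?h \<in> wedge_annihilator L H 0 S"
    by (rule wedge_annihilator_add)
  moreover have "?l \<in> wedge_annihilator L L 2 S"
    using assms(1) by (rule wedge_sum_in_wedge_annihilator_self)
  moreover have "defect H L T (S - T) = (?h + ?l * ?h) + ?l"
    using assms by (simp add: defect_Diff algebra_simps)
  ultimately show ?thesis by (simp add: alternating_coeffs_def set_plus_intro)
qed

lemma defect_mult_alternating:
  assumes "x \<in> alternating_coeffs H L n T" "finite S" "T \<subseteq> S" "n > 0"
  shows "defect H L T (S - T) * x \<in> alternating_coeffs H L (Suc n) S"
proof -
  let ?h = "wedge_sum (T \<inter> H) (S \<inter> H)" and ?l = "wedge_sum (T \<inter> L) (S \<inter> L)"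
  from assms(1) obtain p q where sum: "x = p + q"
      and killed: "\<And>U. p * wedge_sum (T \<inter> H) U = 0" "\<And>U. q * wedge_sum (T \<inter> L) U = 0"
      and degree: "degree_ge L (2 * ((n - 1) div 2)) p" "degree_ge L (2 * (n div 2)) q"
    unfolding alternating_coeffs_def wedge_annihilator_def by (auto elim!: set_plus_elim)
  have "defect H L T (S - T) * x
      = q * ?h + p * ?l + p * ?h + q * ?l + (p * ?h) * ?l + (q * ?l) * ?h"
    using assms(2,3) by (simp add: defect_Diff sum algebra_simps)
  also have "\<dots> = q * ?h + p * ?l" by (simp add: killed)
  also have "\<dots> \<in> wedge_annihilator L H (2 * (n div 2)) S
      + wedge_annihilator L L (2 * (Suc n div 2)) S"
  proof (rule set_plus_intro)
    show "q * ?h \<in> wedge_annihilator L H (2 * (n div 2)) S"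
      using wedge_annihilator_mult[OF degree(2) wedge_sum_in_wedge_annihilator] assms(2) by simp
    have "2 * ((n - 1) div 2) + 2 = 2 * (Suc n div 2)" using assms(4) by (cases n) auto
    then show "p * ?l \<in> wedge_annihilator L L (2 * (Suc n div 2)) S"
      using wedge_annihilator_mult[OF degree(1) wedge_sum_in_wedge_annihilator_self] assms(2) by metis
  qed
  finally show ?thesis by (simp add: alternating_coeffs_def)
qed

lemma lcomm_doubly_twisted_ring_alternating:
  assumes "2 \<le> n" "length us = n" "set us \<subseteq> finitary" "finite S"
  shows "lcomm (doubly_twisted_ring H L) us S \<in> alternating_coeffs H L n S"
  using assms
proof (induction n arbitrary: us S rule: dec_induct)
  case base
  then obtain f g where us: "us = [f, g]"
    by (auto simp: numeral_2_eq_2 length_Suc_conv)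
  have "defect H L T (S - T) * (f T * (bichar (twist H L) (S - T) T * g (S - T)))
      \<in> alternating_coeffs H L 2 S" if "T \<in> Pow S" for T
    using that \<open>finite S\<close> by (auto intro: alternating_coeffs_mult defect_alternating)
  then show ?case
    by (auto simp: us comm2_doubly_twisted_ring mult.assoc intro!: alternating_coeffs_sum)
next
  case (step n)
  then obtain vs g where us: "us = vs @ [g]" "length vs = n"
    by (metis length_Suc_conv_rev)
  then have "vs \<noteq> []" using step.hyps by auto
  let ?f = "lcomm (doubly_twisted_ring H L) vs"
  have "defect H L T (S - T) * ?f T * (bichar (twist H L) (S - T) T * g (S - T))
      \<in> alternating_coeffs H L (Suc n) S" if "T \<in> Pow S" for T
  proof (rule alternating_coeffs_mult[OF defect_mult_alternating])
    show "?f T \<in> alternating_coeffs H L n T"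
      using that us step.prems by (intro step.IH) (auto intro: finite_subset)
  qed (use that step in auto)
  then show ?case
    using \<open>vs \<noteq> []\<close>
    by (auto simp: us lcomm_snoc comm2_doubly_twisted_ring intro!: alternating_coeffs_sum)
qed

lemma lcomm_doubly_twisted_ring_eq_zero:
  assumes "finite L" "card L + 3 \<le> length us" "set us \<subseteq> finitary"
  shows "lcomm (doubly_twisted_ring H L) us = (\<lambda>_. 0)"
proof
  fix S
  show "lcomm (doubly_twisted_ring H L) us S = 0"
  proof (cases "finite S")
    case True
    then have "lcomm (doubly_twisted_ring H L) us S \<in> alternating_coeffs H L (length us) S"
      using assms(2,3) by (intro lcomm_doubly_twisted_ring_alternating) auto
    then obtain p q where "lcomm (doubly_twisted_ring H L) us S = p + q"
        and "degree_ge L (2 * ((length us - 1) div 2)) p" "degree_ge L (2 * (length us div 2)) q"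
      unfolding alternating_coeffs_def wedge_annihilator_def by (blast elim: set_plus_elim)
    moreover have "card L < 2 * ((length us - 1) div 2)" "card L < 2 * (length us div 2)"
      using assms(2) by presburger+
    ultimately show ?thesis
      using assms(1) degree_ge_gt_card by (metis add.right_neutral)
  next
    case False
    have "lcomm (doubly_twisted_ring H L) us \<in> finitary"
      using ring.lcomm_closed[OF ring_twisted_ring, of us] assms(3) by simp
    then show ?thesis using False by (rule finitaryD)
  qed
qed

section \<open>Nonvanishing products of commutators\<close>

definition assoc_monomial :: "'i::linorder set \<Rightarrow> ('i, 'f::comm_ring_1) even_grassmann \<Rightarrow> bool"
  where "assoc_monomial P x \<longleftrightarrow>
    finite P \<and> even (card P) \<and> x dvd even_monomial 1 P \<and> even_monomial 1 P dvd x"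

lemma assoc_monomial_nonzero:
  assumes "assoc_monomial P x"
  shows "x \<noteq> 0"
proof
  assume "x = 0"
  with assms have "even_monomial 1 P = (0 :: ('a, 'b) even_grassmann)"
    by (simp add: assoc_monomial_def)
  with assms show False by (simp add: assoc_monomial_def even_monomial_nonzero)
qed

lemma assoc_monomial_one: "assoc_monomial {} 1"
  by (simp add: assoc_monomial_def even_monomial_empty)

lemma assoc_monomial_unit_mult:
  assumes "e dvd 1" "assoc_monomial P x"
  shows "assoc_monomial P (e * x)"
  using assms mult_dvd_mono[OF assms(1), of x "even_monomial 1 P"] by (auto simp: assoc_monomial_def)

lemma assoc_monomial_even_monomial:
  fixes P :: "'i::linorder set" and c :: "'f::comm_ring_1"
  assumes "finite P" "even (card P)" "c dvd 1"
  shows "assoc_monomial P (even_monomial c P)"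
proof -
  have scale: "even_monomial (e * d) P = even_monomial e {} * even_monomial d P" for d e :: 'f
    using assms(1,2) by (simp add: even_monomial_mult_disjoint)
  from assms(3) obtain d where "1 = d * c" by (metis dvdE mult.commute)
  with scale[of d c] have "even_monomial c P dvd even_monomial 1 P" by simp
  moreover from scale[of c 1] have "even_monomial 1 P dvd even_monomial c P" by simp
  ultimately show ?thesis using assms(1,2) by (simp add: assoc_monomial_def)
qed

lemma assoc_monomial_mult:
  assumes "assoc_monomial P x" "assoc_monomial Q y" "P \<inter> Q = {}"
  shows "assoc_monomial (P \<union> Q) (x * y)"
proof -
  let ?m = "even_monomial 1 P * even_monomial 1 Q"
  have "x * y dvd ?m" "?m dvd x * y"
    using assms(1,2) by (auto simp: assoc_monomial_def intro: mult_dvd_mono)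
  moreover have "?m = even_monomial (bichar inversion_sign P Q) (P \<union> Q)"
    using assms by (simp add: assoc_monomial_def even_monomial_mult_disjoint)
  moreover have "assoc_monomial (P \<union> Q) (even_monomial (bichar inversion_sign P Q :: 'b) (P \<union> Q))"
    using assms by (intro assoc_monomial_even_monomial bichar_dvd_1 inversion_sign_dvd_1)
      (auto simp: assoc_monomial_def card_Un_disjoint)
  ultimately show ?thesis unfolding assoc_monomial_def by (metis dvd_trans)
qed

lemma assoc_monomial_wedge: "i \<noteq> j \<Longrightarrow> assoc_monomial {i, j} (wedge i j)"
  unfolding wedge_def by (auto intro!: assoc_monomial_even_monomial inversion_sign_dvd_1)

lemma assoc_monomial_mult_wedge_eq_zero:
  assumes "assoc_monomial P x" "i \<in> P"
  shows "x * wedge i j = 0"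
proof -
  obtain y where "x = even_monomial 1 P * y"
    using assms(1) unfolding assoc_monomial_def by blast
  moreover have "even_monomial 1 P * wedge i j = (0 :: ('a, 'b) even_grassmann)"
    using assms by (intro even_monomial_mult_wedge_meet) (auto simp: assoc_monomial_def)
  ultimately show ?thesis by (metis mult.assoc mult.commute mult_zero_right)
qed

lemma assoc_monomial_mult_wedge_sum:
  assumes "assoc_monomial P x" "finite S"
  shows "x * wedge_sum S T = x * wedge_sum (S - P) T"
proof -
  have "x * wedge_sum S T = (\<Sum>i\<in>S. \<Sum>j\<in>T. x * wedge i j)"
    by (simp add: wedge_sum_def sum_distrib_left)
  also have "\<dots> = (\<Sum>i\<in>S - P. \<Sum>j\<in>T. x * wedge i j)"
    using assms by (intro sum.mono_neutral_right) (auto simp: assoc_monomial_mult_wedge_eq_zero)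
  finally show ?thesis by (simp add: wedge_sum_def sum_distrib_left)
qed

lemma assoc_monomial_defect:
  assumes assoc: "assoc_monomial P x" and "finite S" "i \<noteq> j" "j \<notin> P"
    and unpaired: "S \<inter> H - P = {i}" "T \<inter> H = {j}" "S \<inter> L - P = {}"
  shows "assoc_monomial (P \<union> {i, j}) (defect H L S T * x)"
proof -
  have "x * wedge_sum (S \<inter> H) (T \<inter> H) = x * wedge i j"
    using assoc_monomial_mult_wedge_sum[OF assoc, of "S \<inter> H" "T \<inter> H"] \<open>finite S\<close>
    by (simp add: unpaired wedge_sum_def)
  moreover have "x * wedge_sum (S \<inter> L) (T \<inter> L) = 0"
    using assoc_monomial_mult_wedge_sum[OF assoc, of "S \<inter> L" "T \<inter> L"] \<open>finite S\<close>
    by (simp add: unpaired)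
  ultimately have "defect H L S T * x = x * wedge i j"
    by (simp add: defect_def algebra_simps) (metis mult.left_commute mult_zero_right)
  moreover have "assoc_monomial (P \<union> {i, j}) (x * wedge i j)"
    using assoc assoc_monomial_wedge[OF \<open>i \<noteq> j\<close>] unpaired \<open>j \<notin> P\<close> by (intro assoc_monomial_mult) auto
  ultimately show ?thesis by simp
qed

text \<open>The index \<open>(i, j, b)\<close> belongs to the \<open>j\<close>-th entry of the \<open>i\<close>-th commutator. Indices
  \<open>(i, j, True)\<close> outside \<open>low k m\<close> take no part in the twist.\<close>

definition entry :: "nat \<Rightarrow> nat \<Rightarrow> (nat \<times> nat \<times> bool) set"
  where "entry i j = {i} \<times> {j} \<times> UNIV"

definition entries :: "nat \<Rightarrow> nat \<Rightarrow> (nat \<times> nat \<times> bool) set"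
  where "entries i n = {i} \<times> {..<n} \<times> UNIV"

definition high :: "(nat \<times> nat \<times> bool) set"
  where "high = UNIV \<times> UNIV \<times> {False}"

definition low :: "nat \<Rightarrow> (nat \<Rightarrow> nat) \<Rightarrow> (nat \<times> nat \<times> bool) set"
  where "low k m = (SIGMA i:{..<k}. {1..2 * ((m i - 1) div 2)} \<times> {True})"

definition paired :: "nat \<Rightarrow> nat \<Rightarrow> (nat \<times> nat \<times> bool) set"
  where "paired i n = {i} \<times> ({..<2 * (n div 2)} \<times> {False} \<union> {1..2 * ((n - 1) div 2)} \<times> {True})"

lemma finite_entry [simp]: "finite (entry i j)"
  by (simp add: entry_def)

lemma finite_entries [simp]: "finite (entries i n)"
  by (simp add: entries_def)

lemma finite_low: "finite (low k m)"
  by (simp add: low_def)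

lemma card_low_add_2:
  fixes k l :: nat and m :: "nat \<Rightarrow> nat"
  assumes "\<forall>i<k. m i > 0" "card {i. i < k \<and> odd (m i)} = l"
  shows "card (low k m) + 2 = nat (int (\<Sum>i<k. m i) - 2 * int k + int l + 2)"
proof -
  have "{..<k} \<inter> {i. odd (m i)} = {i. i < k \<and> odd (m i)}" by auto
  then have "(\<Sum>i<k. if odd (m i) then 1 else 0) = l"
    using assms(2) by (simp add: sum.If_cases)
  then have "(\<Sum>i<k. m i) + l = (\<Sum>i<k. m i + (if odd (m i) then 1 else 0))"
    by (simp add: sum.distrib)
  also have "\<dots> = (\<Sum>i<k. 2 * ((m i - 1) div 2) + 2)"
  proof (intro sum.cong refl)
    fix i assume "i \<in> {..<k}"
    then have "m i > 0" using assms(1) by simp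
    then show "m i + (if odd (m i) then 1 else 0) = 2 * ((m i - 1) div 2) + 2" by presburger
  qed
  also have "\<dots> = card (low k m) + 2 * k"
    by (subst sum.distrib) (simp add: low_def card_cartesian_product)
  finally show ?thesis by linarith
qed

lemma entries_Suc: "entries i (Suc n) = entries i n \<union> entry i n"
  by (auto simp: entries_def entry_def)

lemma entries_fresh: "entries i n \<inter> entry i n = {}"
  by (auto simp: entries_def entry_def)

lemma paired_subset_entries: "paired i n \<subseteq> entries i n"
  by (auto simp: paired_def entries_def)

lemma paired_Suc_odd: "odd n \<Longrightarrow> paired i (Suc n) = paired i n \<union> {(i, n - 1, False), (i, n, False)}"
  by (auto simp: paired_def elim!: oddE)

lemma paired_Suc_even:
  "even n \<Longrightarrow> n > 0 \<Longrightarrow> paired i (Suc n) = paired i n \<union> {(i, n - 1, True), (i, n, True)}"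
  by (auto simp: paired_def elim!: evenE)

lemma assoc_monomial_defect_entry:
  assumes "assoc_monomial (paired i n) c" "0 < n" "n < m i" "i < k"
  shows "assoc_monomial (paired i (Suc n)) (defect high (low k m) (entries i n) (entry i n) * c)"
proof (cases "odd n")
  case True
  have "assoc_monomial (paired i n \<union> {(i, n - 1, False), (i, n, False)})
      (defect high (low k m) (entries i n) (entry i n) * c)"
    using True assms(2-4)
    by (intro assoc_monomial_defect[OF assms(1)])
      (auto simp: entries_def entry_def paired_def high_def low_def elim!: oddE)
  then show ?thesis by (simp add: paired_Suc_odd True)
next
  case False
  then have "n \<le> 2 * ((m i - 1) div 2)" using assms(3) by presburger
  with False have "assoc_monomial (paired i n \<union> {(i, n - 1, True), (i, n, True)})
      (defect (low k m) high (entries i n) (entry i n) * c)"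
    using assms(2-4)
    by (intro assoc_monomial_defect[OF assms(1)])
      (auto simp: entries_def entry_def paired_def high_def low_def elim!: evenE)
  then show ?thesis
    using False assms(2) by (simp add: paired_Suc_even defect_commute)
qed

definition entry_monomials :: "nat \<Rightarrow> nat \<Rightarrow> ((nat \<times> nat \<times> bool) set \<Rightarrow> 'r::comm_ring_1) list"
  where "entry_monomials i n = map (\<lambda>j. monomial 1 (entry i j)) [0..<n]"

lemma lcomm_entry_monomials:
  assumes "0 < n" "n \<le> m i" "i < k"
  shows "\<exists>c. lcomm (doubly_twisted_ring high (low k m)) (entry_monomials i n)
      = monomial (c :: (_, 'f::comm_ring_1) even_grassmann) (entries i n)
    \<and> assoc_monomial (paired i n) c"
  using assms(1,2)
proof (induction n rule: nat_induct_non_zero)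
  case 1
  have "entries i 1 = entry i 0" "paired i 1 = {}"
    by (auto simp: entries_def entry_def paired_def)
  then show ?case using assoc_monomial_one by (auto simp: entry_monomials_def)
next
  case (Suc n)
  let ?R = "doubly_twisted_ring high (low k m) :: (_ \<Rightarrow> (_, 'f) even_grassmann) ring"
    and ?S = "entries i n" and ?T = "entry i n"
  from Suc obtain c :: "(_, 'f) even_grassmann"
    where lcomm_n: "lcomm ?R (entry_monomials i n) = monomial c ?S"
      and assoc: "assoc_monomial (paired i n) c"
    by auto
  let ?d = "bichar (twist high (low k m)) ?T ?S * (defect high (low k m) ?S ?T * c)"
  have "lcomm ?R (entry_monomials i (Suc n)) = comm2 ?R (monomial c ?S) (monomial 1 ?T)"
    using Suc.hyps lcomm_n by (simp add: lcomm_snoc entry_monomials_def)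
  also have "\<dots> = monomial ?d (entries i (Suc n))"
    by (simp add: comm2_doubly_twisted_ring_monomial entries_fresh entries_Suc)
  finally have "lcomm ?R (entry_monomials i (Suc n)) = monomial ?d (entries i (Suc n))" .
  moreover have "assoc_monomial (paired i (Suc n)) ?d"
    using Suc.hyps Suc.prems assoc assms(3)
    by (intro assoc_monomial_unit_mult bichar_twist_dvd_1 assoc_monomial_defect_entry) auto
  ultimately show ?case by blast
qed

lemma prod_lcomm_entry_monomials:
  assumes "\<And>i. i < k \<Longrightarrow> m i > 0" "n \<le> k"
  shows "\<exists>c. prod_lcomm (doubly_twisted_ring high (low k m)) (\<lambda>i. entry_monomials i (m i)) n
      = monomial (c :: (_, 'f::comm_ring_1) even_grassmann) (\<Union>i<n. entries i (m i))
    \<and> assoc_monomial (\<Union>i<n. paired i (m i)) c"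
  using assms(2)
proof (induction n)
  case 0
  show ?case using assoc_monomial_one by auto
next
  case (Suc n)
  let ?R = "doubly_twisted_ring high (low k m) :: (_ \<Rightarrow> (_, 'f) even_grassmann) ring"
    and ?S = "\<Union>i<n. entries i (m i)" and ?T = "entries n (m n)"
    and ?P = "\<Union>i<n. paired i (m i)" and ?Q = "paired n (m n)"
  from Suc obtain c :: "(_, 'f) even_grassmann"
    where prod_n: "prod_lcomm ?R (\<lambda>i. entry_monomials i (m i)) n = monomial c ?S"
      and assoc_c: "assoc_monomial ?P c"
    by auto
  obtain d :: "(_, 'f) even_grassmann"
    where factor: "lcomm ?R (entry_monomials n (m n)) = monomial d ?T"
      and assoc_d: "assoc_monomial ?Q d"
    using lcomm_entry_monomials[of "m n" m n k] assms(1) Suc.prems by auto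
  let ?e = "bichar (twist high (low k m)) ?S ?T * (c * d)"
  have disjoint: "?S \<inter> ?T = {}" by (auto simp: entries_def)
  have "?P \<subseteq> ?S" by (intro UN_mono paired_subset_entries) simp
  with disjoint have "?P \<inter> ?Q = {}" using paired_subset_entries[of n "m n"] by blast
  with assoc_c assoc_d have "assoc_monomial (?P \<union> ?Q) ?e"
    by (intro assoc_monomial_unit_mult[OF bichar_twist_dvd_1] assoc_monomial_mult)
  moreover have "prod_lcomm ?R (\<lambda>i. entry_monomials i (m i)) (Suc n) = monomial ?e (?S \<union> ?T)"
    using prod_n factor disjoint by (simp add: twisted_conv_monomial_disjoint mult.assoc)
  ultimately show ?case by (auto simp: lessThan_Suc Un_commute)
qed

lemma prod_lcomm_entry_monomials_nonzero:
  assumes "\<And>i. i < k \<Longrightarrow> m i > 0"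
  shows "prod_lcomm (doubly_twisted_ring high (low k m)) (\<lambda>i. entry_monomials i (m i)) k
    \<noteq> (\<lambda>_. 0 :: (_, 'f::comm_ring_1) even_grassmann)"
proof -
  from prod_lcomm_entry_monomials[of k m k, OF assms order.refl] obtain c :: "(_, 'f) even_grassmann"
    where "prod_lcomm (doubly_twisted_ring high (low k m)) (\<lambda>i. entry_monomials i (m i)) k
        = monomial c (\<Union>i<k. entries i (m i))" "assoc_monomial (\<Union>i<k. paired i (m i)) c"
    by blast
  then show ?thesis
    using assoc_monomial_nonzero by (auto simp: monomial_def fun_eq_iff)
qed

section \<open>Encoding as functions on lists\<close>

definition decode_set :: "nat \<Rightarrow> 'i::countable set"
  where "decode_set n = to_nat -` set_decode n"

lemma decode_set_surj: "finite S \<Longrightarrow> \<exists>n. decode_set n = S"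
  by (intro exI[of _ "set_encode (to_nat ` S)"]) (simp add: decode_set_def inj_vimage_image_eq)

text \<open>Only the lists of length two matter; \<open>xs ! 1\<close> is a junk value for shorter ones.\<close>

definition encode :: "('i::countable set \<Rightarrow> ('i, 'f::comm_ring_1) even_grassmann) \<Rightarrow> nat list \<Rightarrow> 'f"
  where "encode f xs = coef (f (decode_set (xs ! 0))) (decode_set (xs ! 1))"

lemma inj_on_encode: "inj_on encode finitary"
proof (intro inj_onI ext even_grassmann_eqI)
  fix f g :: "'i::{countable, linorder} set \<Rightarrow> ('i, 'f::comm_ring_1) even_grassmann" and S P
  assume finitary: "f \<in> finitary" "g \<in> finitary" and eq: "encode f = encode g"
  show "coef (f S) P = coef (g S) P"
  proof (cases "finite S \<and> finite P")
    case True
    then obtain a b where "decode_set a = S" "decode_set b = P"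
      using decode_set_surj by metis
    then show ?thesis
      using fun_cong[OF eq, of "[a, b]"] by (simp add: encode_def)
  next
    case False
    then show ?thesis
      using finitary by (auto simp: finitaryD finitaryD[OF coef_finitary])
  qed
qed

theorem theorem1p9:
  fixes k l :: nat and m :: "nat \<Rightarrow> nat"
  assumes "k > 0" and "l \<le> k"
    and "\<forall>i<k. m i > 0"
    and "card {i. i < k \<and> odd (m i)} = l"
    and "card {i. i < k \<and> even (m i)} = k - l"
  shows "\<exists>(A :: (nat list \<Rightarrow> 'f::field) ring) (sm :: 'f \<Rightarrow> (nat list \<Rightarrow> 'f) \<Rightarrow> (nat list \<Rightarrow> 'f)).
           unital_F_algebra sm A \<and>
           (let N = nat (int (\<Sum>i<k. m i) - 2 * int k + int l + 2) in
              Tn (1 + N) A = {\<zero>\<^bsub>A\<^esub>} \<and>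
              (\<forall>us. length us = 1 + N \<and> set us \<subseteq> carrier A \<longrightarrow> lcomm A us = \<zero>\<^bsub>A\<^esub>)) \<and>
           (\<exists>v :: nat \<Rightarrow> nat \<Rightarrow> (nat list \<Rightarrow> 'f).
              (\<forall>i j. i < k \<and> j < m i \<longrightarrow> v i j \<in> carrier A) \<and>
              foldl (\<lambda>acc i. acc \<otimes>\<^bsub>A\<^esub> lcomm A (map (v i) [0..<m i])) \<one>\<^bsub>A\<^esub> [0..<k]
                \<noteq> \<zero>\<^bsub>A\<^esub>)"
proof -
  define R where "R = (doubly_twisted_ring high (low k m) :: (_ \<Rightarrow> (_, 'f) even_grassmann) ring)"
  define A where "A = image_ring encode R"
  define v where "v = (\<lambda>i j. encode (monomial (1 :: (_, 'f) even_grassmann) (entry i j)))"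
  have inj: "inj_on encode (carrier R)" by (simp add: R_def inj_on_encode)
  interpret R: ring R unfolding R_def by (rule ring_twisted_ring)
  interpret encode: ring_hom_ring R A encode
    unfolding A_def using inj by (rule R.ring_hom_ring_image_ring)
  have algebra: "\<exists>sm :: 'f \<Rightarrow> _. unital_F_algebra sm A"
    using unital_F_algebra_image_ring[OF unital_F_algebra_doubly_twisted_ring] inj
    unfolding A_def R_def by blast
  have nilpotent: "lcomm A us = \<zero>\<^bsub>A\<^esub>"
    if "length us = 1 + (card (low k m) + 2)" "set us \<subseteq> carrier A" for us
    using that
    by (intro encode.lcomm_eq_zero_if_surj)
      (auto simp: A_def R_def image_ring_carrier intro!: lcomm_doubly_twisted_ring_eq_zero finite_low)
  then have "Tn (1 + (card (low k m) + 2)) A = {\<zero>\<^bsub>A\<^esub>}" by (intro encode.S.Tn_eq_zero) auto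
  moreover have "prod_lcomm A (\<lambda>i. map encode (entry_monomials i (m i))) k \<noteq> \<zero>\<^bsub>A\<^esub>"
    using inj prod_lcomm_entry_monomials_nonzero assms(3)
    by (intro encode.prod_lcomm_nonzero_if_inj) (auto simp: R_def entry_monomials_def)
  then have "foldl (\<lambda>acc i. acc \<otimes>\<^bsub>A\<^esub> lcomm A (map (v i) [0..<m i])) \<one>\<^bsub>A\<^esub> [0..<k] \<noteq> \<zero>\<^bsub>A\<^esub>"
    by (simp add: prod_lcomm_def entry_monomials_def v_def comp_def)
  moreover have "v i j \<in> carrier A" for i j by (simp add: v_def A_def R_def image_ring_carrier)
  ultimately show ?thesis
    unfolding Let_def card_low_add_2[OF assms(3,4), symmetric] using algebra nilpotent by blast
qed

end
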